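(* The $(q,r)$-Whitney-Lah numbers $L_{m,r}[n,k]_q$ satisfy the horizontal recurrence relation $$L_{m,r}[n,k]_q=\sum_{j=0}^{n-k}(-1)^j\,q^{-2r-m(k+j)-nm}\,\frac{r_{k+j+1,q}}{r_{k+1,q}}\,L_{m,r}[n+1,k+j+1]_q,$$ where $$r_{i,q}=\prod_{h=1}^{i-1}q^{-2r-mh-nm+m}[mh+2r+nm]_q,$$ with initial value $L_{m,r}[0,0]_q=1$.
   Context: Here $q,m,r$ are parameters, and $[x]_q=\frac{q^x-1}{q-1}$, so that $[t-k]_q=\frac{1}{q^k}([t]_q-[k]_q)$. The $(q,r)$-Whitney-Lah numbers are defined by $$L_{m,r}[n,k]_q=q^{2r+m(k-1)+m(n-1)}L_{m,r}[n-1,k-1]_q+[2r+km+(n-1)m]_q\,L_{m,r}[n-1,k]_q,$$ with $L_{m,r}[n,k]_q=0$ if $n<k$ or $n,k<0$, and $L_{m,r}[n,k]_q=1$ if $n=k$ and $n\ge 0$.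
   Formalization: The convention L[n,n]=1 for all n≥0 contradicts the recurrence (which gives L[1,1]=q^{2r}), so only L[0,0]=1 is kept and the recurrence is used for n≥1; q, m, r are complex with principal powers, q≠0,1, k≥0 and r_{k+1,q}≠0. *)

theory Defs
  imports "HOL-Analysis.Analysis"
begin

text \<open>
  The parameters \<open>q\<close>, \<open>m\<close>, \<open>r\<close> are complex. A power \<open>q\<^sup>x\<close> is \<open>q powr x\<close> (principal branch), which agrees
  with the usual power for positive real \<open>q\<close> and real \<open>x\<close>, and for nonzero \<open>q\<close> and integer \<open>x\<close>.
\<close>

definition q_num :: "complex \<Rightarrow> complex \<Rightarrow> complex" where
  "q_num q x = (q powr x - 1) / (q - 1)"

text \<open>
  The indices are integers, so that the terms with a negative index are literally present in the
  recurrence. The only nonzero initial value is \<open>L[0,0] = 1\<close>: requiring \<open>L[n,n] = 1\<close> for every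
  \<open>n \<ge> 0\<close> would contradict the recurrence, which gives \<open>L[1,1] = q\<^bsup>2r\<^esup>\<close>.
\<close>

function whitney_lah :: "complex \<Rightarrow> complex \<Rightarrow> complex \<Rightarrow> int \<Rightarrow> int \<Rightarrow> complex" where
  "whitney_lah q m r n k =
     (if n < k \<or> n < 0 \<or> k < 0 then 0
      else if n = 0 then 1
      else q powr (2 * r + m * of_int (k - 1) + m * of_int (n - 1)) * whitney_lah q m r (n - 1) (k - 1)
         + q_num q (2 * r + of_int k * m + of_int (n - 1) * m) * whitney_lah q m r (n - 1) k)"
  by auto
termination
  by (relation "Wellfounded.measure (\<lambda>(q, m, r, n, k). nat n)") auto

declare whitney_lah.simps [simp del]

lemma whitney_lah_0_0: "whitney_lah q m r 0 0 = 1"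
  by (simp add: whitney_lah.simps)

lemma whitney_lah_eq_0: "n < k \<or> n < 0 \<or> k < 0 \<Longrightarrow> whitney_lah q m r n k = 0"
  by (simp add: whitney_lah.simps)

lemma whitney_lah_rec:
  assumes "n \<ge> 1"
  shows "whitney_lah q m r n k =
      q powr (2 * r + m * of_int (k - 1) + m * of_int (n - 1)) * whitney_lah q m r (n - 1) (k - 1)
    + q_num q (2 * r + of_int k * m + of_int (n - 1) * m) * whitney_lah q m r (n - 1) k"
proof (cases "n < k \<or> k < 0")
  case True
  then show ?thesis by (auto simp: whitney_lah_eq_0)
next
  case False
  then show ?thesis using assms by (subst whitney_lah.simps) auto
qed

lemma whitney_lah_1_1: "whitney_lah q m r 1 1 = q powr (2 * r)"
  by (simp add: whitney_lah_rec[of 1] whitney_lah_0_0 whitney_lah_eq_0)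

text \<open>The quantity \<open>r\<^bsub>i,q\<^esub>\<close>, which also depends on \<open>n\<close>.\<close>

definition r_prod :: "complex \<Rightarrow> complex \<Rightarrow> complex \<Rightarrow> int \<Rightarrow> int \<Rightarrow> complex" where
  "r_prod q m r n i =
     (\<Prod>h = 1..i - 1. q powr (- 2 * r - m * of_int h - of_int n * m + m)
                    * q_num q (m * of_int h + 2 * r + of_int n * m))"

end

theory Submission
  imports Defs
begin

text \<open>
  Expanding \<open>L[n+1,k+j+1]\<close> by its defining recurrence turns the \<open>j\<close>-th summand into
  \<open>T j - T (j+1)\<close> with \<open>T j = (-1)\<^sup>j (r\<^bsub>k+j+1,q\<^esub> / r\<^bsub>k+1,q\<^esub>) L[n,k+j]\<close>, because the factors of
  \<open>r\<^bsub>i,q\<^esub>\<close> are the ratios of the two coefficients of the recurrence. The sum telescopes to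
  \<open>T 0 = L[n,k]\<close>, the other end vanishing since \<open>L[n,n+1] = 0\<close>.
\<close>

lemma sum_telescope_int:
  fixes f :: "int \<Rightarrow> 'a::ab_group_add"
  assumes "a \<le> b + 1"
  shows "(\<Sum>j = a..b. f j - f (j + 1)) = f a - f (b + 1)"
proof -
  \<comment> \<open>The induction starts from the empty range \<open>b = a - 1\<close>.\<close>
  have "a - 1 \<le> b" using assms by simp
  then show ?thesis
  proof (induction b rule: int_ge_induct)
    case base
    then show ?case by simp
  next
    case (step b)
    have "{a..b + 1} = insert (b + 1) {a..b}" using step.hyps by auto
    then show ?case using step.IH by simp
  qed
qed

lemma r_prod_Suc:
  assumes "i \<ge> 1"
  shows "r_prod q m r n (i + 1) = r_prod q m r n i
    * (q powr (- 2 * r - m * of_int i - of_int n * m + m)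
       * q_num q (m * of_int i + 2 * r + of_int n * m))"
proof -
  have "{1..i + 1 - 1} = insert i {1..i - 1}" using assms by auto
  then show ?thesis unfolding r_prod_def by (simp add: mult.commute)
qed

theorem theorem2p5:
  fixes q m r :: complex and n k :: int
  assumes "q \<noteq> 0" and "q \<noteq> 1" and "0 \<le> k"
    and "r_prod q m r n (k + 1) \<noteq> 0"
  shows "whitney_lah q m r n k =
      (\<Sum>j = 0..n - k. (-1) ^ nat j
         * q powr (- 2 * r - m * of_int (k + j) - of_int n * m)
         * (r_prod q m r n (k + j + 1) / r_prod q m r n (k + 1))
         * whitney_lah q m r (n + 1) (k + j + 1))
    \<and> whitney_lah q m r 0 0 = 1"
proof (cases "n < k")
  case True
  then show ?thesis by (simp add: whitney_lah_eq_0 whitney_lah_0_0)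
next
  case False
  define T where "T j = (-1) ^ nat j
      * (r_prod q m r n (k + j + 1) / r_prod q m r n (k + 1)) * whitney_lah q m r n (k + j)" for j
  have step: "(-1) ^ nat j
         * q powr (- 2 * r - m * of_int (k + j) - of_int n * m)
         * (r_prod q m r n (k + j + 1) / r_prod q m r n (k + 1))
         * whitney_lah q m r (n + 1) (k + j + 1) = T j - T (j + 1)" if "j \<ge> 0" for j
  proof -
    \<comment> \<open>\<open>q powr x\<close> and \<open>y\<close> are the two coefficients in the
      recurrence for \<open>L[n+1,k+j+1]\<close>.\<close>
    define x where "x = 2 * r + m * of_int (k + j) + m * of_int n"
    define y where "y = q_num q (2 * r + of_int (k + j + 1) * m + of_int n * m)"
    have L: "whitney_lah q m r (n + 1) (k + j + 1)
        = q powr x * whitney_lah q m r n (k + j) + y * whitney_lah q m r n (k + j + 1)"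
      using whitney_lah_rec[of "n + 1" q m r "k + j + 1"] False assms(3)
      by (simp add: x_def y_def)
    \<comment> \<open>The extra \<open>+ m\<close> in the exponent of \<open>r_prod\<close> offsets
      the shift from \<open>k + j\<close> to \<open>k + j + 1\<close>, leaving exactly
      \<open>- x\<close>.\<close>
    have R: "r_prod q m r n (k + j + 1 + 1) = r_prod q m r n (k + j + 1) * (q powr (- x) * y)"
      using r_prod_Suc[of "k + j + 1" q m r n] assms(3) that
      by (simp add: x_def y_def algebra_simps)
    have inv: "q powr (- x) * q powr x = 1"
      using assms(1) by (simp add: powr_minus)
    have e: "- 2 * r - m * of_int (k + j) - of_int n * m = - x"
      by (simp add: x_def algebra_simps)
    have s: "nat (j + 1) = Suc (nat j)" using that by simp
    \<comment> \<open>The prefactor \<open>u\<close> cancels \<open>v\<close> in the first term; in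
      the second it joins \<open>y\<close> to form the next factor of \<open>r_prod\<close>.\<close>
    have cancel: "s * u * c * (v * l + y * l') = s * c * l + s * (c * (u * y)) * l'"
      if "u * v = 1" for s u v c l l' :: complex
    proof -
      have "s * u * c * (v * l + y * l') = s * c * l * (u * v) + s * (c * (u * y)) * l'"
        by (simp add: algebra_simps)
      then show ?thesis using that by simp
    qed
    have T': "T (j + 1) = - ((-1) ^ nat j * (r_prod q m r n (k + j + 1) / r_prod q m r n (k + 1)
        * (q powr (- x) * y)) * whitney_lah q m r n (k + j + 1))"
      using R by (simp add: T_def s add.assoc)
    show ?thesis
      unfolding e L cancel[OF inv] T' by (simp add: T_def)
  qed
  have "(\<Sum>j = 0..n - k. T j - T (j + 1)) = T 0 - T (n - k + 1)"
    using False by (intro sum_telescope_int) simp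
  \<comment> \<open>The ratio in \<open>T 0\<close> is 1 only because its denominator is nonzero;
    division by zero would give 0.\<close>
  also have "\<dots> = whitney_lah q m r n k"
    using assms(4) by (simp add: T_def whitney_lah_eq_0)
  finally show ?thesis
    using step by (simp add: whitney_lah_0_0)
qed

end
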